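(* For every $p\in\mathbb{Z}$ and every integer $n\ge 0$, $$\beta_{n,\lambda}^{(p)}(x)=\sum_{k=0}^{n}\frac{(-\lambda)^{k}(1)_{k+1,1/\lambda}}{(k+1)^{p}}\,S_{2,-\lambda}(n,k\,|\,x-k).$$
   Context: Let $\lambda$ be a nonzero real number. For $\mu\in\mathbb{R}$, $(x)_{0,\mu}=1$, $(x)_{n,\mu}=x(x-\mu)\cdots(x-(n-1)\mu)$ for $n\ge1$, and $e_\mu^x(t)=\sum_{k\ge0}(x)_{k,\mu}t^k/k!$ (formal power series in $t$), $e_\mu(t)=e_\mu^1(t)$. For an integer $k\ge0$ the degenerate Stirling polynomials are defined by $\frac{1}{k!}(e_\mu(t)-1)^k e_\mu^x(t)=\sum_{n\ge k}S_{2,\mu}(n,k\,|\,x)\frac{t^n}{n!}$. For $k\in\mathbb{Z}$, the degenerate polylogarithm is $\mathrm{Li}_{k,\lambda}(y)=\sum_{n\ge1}\frac{(-\lambda)^{n-1}(1)_{n,1/\lambda}}{(n-1)!\,n^k}y^n$. The degenerate poly-Bernoulli polynomials of index $k$ are defined by $\frac{\mathrm{Li}_{k,\lambda}(1-e_\lambda(-t))}{1-e_\lambda(-t)}e_\lambda^{-x}(-t)=\sum_{n\ge0}\beta^{(k)}_{n,\lambda}(x)\frac{t^n}{n!}$. *)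

theory Defs
  imports "HOL-Computational_Algebra.Formal_Power_Series"
begin

definition degen_ffact :: "real \<Rightarrow> nat \<Rightarrow> real \<Rightarrow> real" where
  "degen_ffact \<mu> n x = (\<Prod>i<n. x - real i * \<mu>)"

definition degen_exp :: "real \<Rightarrow> real \<Rightarrow> real fps" where
  "degen_exp \<mu> x = Abs_fps (\<lambda>k. degen_ffact \<mu> k x / fact k)"

definition degen_Stirling2 :: "real \<Rightarrow> nat \<Rightarrow> nat \<Rightarrow> real \<Rightarrow> real" where
  "degen_Stirling2 \<mu> n k x =
     fact n * fps_nth (fps_const (1 / fact k) * (degen_exp \<mu> 1 - 1) ^ k * degen_exp \<mu> x) n"

definition degen_polylog :: "int \<Rightarrow> real \<Rightarrow> real fps" where
  "degen_polylog k lam = Abs_fps (\<lambda>n. if n = 0 then 0 else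
     (- lam) ^ (n - 1) * degen_ffact (1 / lam) n 1 / (fact (n - 1) * real n powi k))"

text \<open>The quotient below is the division of formal power series of the library. It is exact: the
  numerator has vanishing constant term, and \<^term>\<open>1 - (degen_exp lam 1 oo (- fps_X))\<close> has
  subdegree 1 (see the two facts after the definition).\<close>

definition degen_poly_Bernoulli :: "int \<Rightarrow> real \<Rightarrow> nat \<Rightarrow> real \<Rightarrow> real" where
  "degen_poly_Bernoulli k lam n x =
     (let u = 1 - (degen_exp lam 1 oo (- fps_X))
      in fact n * fps_nth ((degen_polylog k lam oo u) / u * (degen_exp lam (- x) oo (- fps_X))) n)"

lemma subdegree_one_minus_degen_exp:
  "subdegree (1 - (degen_exp lam 1 oo (- fps_X))) = 1"
  by (rule subdegreeI) (simp_all add: degen_exp_def degen_ffact_def fps_compose_uminus')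

lemma degen_polylog_quotient_exact:
  fixes k :: int and lam :: real
  defines "u \<equiv> 1 - (degen_exp lam 1 oo (- fps_X))"
  shows "(degen_polylog k lam oo u) / u * u = degen_polylog k lam oo u"
proof (cases "degen_polylog k lam oo u = 0")
  case False
  have "fps_nth (degen_polylog k lam oo u) 0 = 0"
    by (simp add: degen_polylog_def)
  then have "subdegree (degen_polylog k lam oo u) \<ge> 1"
    using False by (intro subdegree_geI) (simp_all del: fps_compose_nth_0)
  then have "subdegree (degen_polylog k lam oo u) \<ge> subdegree u"
    by (simp add: u_def subdegree_one_minus_degen_exp)
  moreover have "u \<noteq> 0"
    using subdegree_one_minus_degen_exp[of lam] by (auto simp: u_def)
  ultimately show ?thesis
    using False by (simp add: fps_dvd_iff)
qed simp

end

theory Submission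
  imports Defs
begin

unbundle fps_syntax

text \<open>Reflection gives \<open>e\<^sub>\<lambda>\<^sup>y(-t) = e\<^sub>\<mu>\<^sup>-\<^sup>y(t)\<close> with \<open>\<mu> = -\<lambda>\<close>, so the generating function
  of the poly-Bernoulli polynomials is \<open>Li(u)/u\<close> times \<open>e\<^sub>\<mu>\<^sup>x(t)\<close> where \<open>u = 1 - e\<^sub>\<mu>\<^sup>-\<^sup>1(t)\<close>.
  The law of exponents turns \<open>u\<^sup>k e\<^sub>\<mu>\<^sup>x(t)\<close> into \<open>(e\<^sub>\<mu>(t) - 1)\<^sup>k e\<^sub>\<mu>\<^sup>x\<^sup>-\<^sup>k(t)\<close>, which is \<open>k!\<close> times
  the generating function of the Stirling polynomials at \<open>x - k\<close>; expanding \<open>Li(u)/u\<close> in powers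
  of \<open>u\<close> gives the claim.\<close>

lemma degen_ffact_uminus: "degen_ffact (- \<mu>) n (- x) = (- 1) ^ n * degen_ffact \<mu> n x"
proof -
  have "degen_ffact (- \<mu>) n (- x) = (\<Prod>i<n. (- 1) * (x - real i * \<mu>))"
    unfolding degen_ffact_def by (rule prod.cong) auto
  then show ?thesis
    by (simp only: prod.distrib degen_ffact_def) simp
qed

lemma degen_exp_compose_uminus_X: "degen_exp \<mu> x oo (- fps_X) = degen_exp (- \<mu>) (- x)"
  by (rule fps_ext) (simp add: fps_compose_uminus' degen_exp_def degen_ffact_uminus)

text \<open>Each factor x - i \<mu> equals \<mu> (x/\<mu> - i), so the series is (1 + \<mu>
  t)^(x/\<mu>); the law of exponents is then inherited from binomial series.\<close>

lemma degen_exp_eq_binomial: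
  assumes "\<mu> \<noteq> 0"
  shows "degen_exp \<mu> x = fps_binomial (x / \<mu>) oo (fps_const \<mu> * fps_X)"
proof (rule fps_ext)
  fix n
  have "degen_ffact \<mu> n x = (\<Prod>i<n. \<mu> * (x / \<mu> - real i))"
    unfolding degen_ffact_def using assms by (intro prod.cong) (auto simp: field_simps)
  also have "\<dots> = \<mu> ^ n * (\<Prod>i<n. x / \<mu> - real i)"
    by (simp add: prod.distrib)
  finally show "degen_exp \<mu> x $ n = (fps_binomial (x / \<mu>) oo (fps_const \<mu> * fps_X)) $ n"
    by (simp add: degen_exp_def fps_compose_linear gbinomial_prod_rev atLeast0LessThan)
qed

lemma degen_exp_add:
  assumes "\<mu> \<noteq> 0"
  shows "degen_exp \<mu> (x + y) = degen_exp \<mu> x * degen_exp \<mu> y"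
  using assms
  by (simp add: degen_exp_eq_binomial add_divide_distrib fps_binomial_add_mult
      fps_compose_mult_distrib)

lemma degen_exp_0: "degen_exp \<mu> 0 = 1"
proof (rule fps_ext)
  fix n
  show "degen_exp \<mu> 0 $ n = 1 $ n"
    \<comment> \<open>For positive n the shift exposes the factor at i = 0, which vanishes.\<close>
    by (cases n) (simp_all add: degen_exp_def degen_ffact_def prod.lessThan_Suc_shift
        del: prod.lessThan_Suc)
qed

text \<open>Each of the k factors e(1) - 1 absorbs one e(-1) split off from e(x - k) and becomes 1 -
  e(-1).\<close>

lemma degen_exp_minus_1_power:
  assumes "\<mu> \<noteq> 0"
  shows "(degen_exp \<mu> 1 - 1) ^ k * degen_exp \<mu> (x - real k) =
    (1 - degen_exp \<mu> (- 1)) ^ k * degen_exp \<mu> x"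
proof (induction k)
  case (Suc k)
  let ?e = "degen_exp \<mu>"
  have "?e (x - real (Suc k)) = ?e (- 1) * ?e (x - real k)"
    using degen_exp_add[OF assms, of "- 1" "x - real k"] by (simp add: algebra_simps)
  then have "(?e 1 - 1) ^ Suc k * ?e (x - real (Suc k)) =
      ((?e 1 - 1) * ?e (- 1)) * ((?e 1 - 1) ^ k * ?e (x - real k))"
    by (simp only: power_Suc mult_ac)
  also have "(?e 1 - 1) * ?e (- 1) = 1 - ?e (- 1)"
    using degen_exp_add[OF assms, of 1 "- 1"] by (simp add: degen_exp_0 algebra_simps)
  finally show ?case
    by (simp only: Suc.IH power_Suc mult.assoc)
qed simp

lemma fps_compose_mult_nth:
  fixes f g h :: "'a :: comm_ring_1 fps"
  assumes "g $ 0 = 0"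
  shows "((f oo g) * h) $ n = (\<Sum>k=0..n. f $ k * (g ^ k * h) $ n)"
proof -
  \<comment> \<open>\<open>g ^ k\<close> has no coefficient at i < k, so the sums for all i can
    share the bound n and be swapped.\<close>
  have "(f oo g) $ i = (\<Sum>k=0..n. f $ k * (g ^ k) $ i)" if "i \<le> n" for i
    unfolding fps_compose_nth using that assms
    by (intro sum.mono_neutral_left) (auto simp: startsby_zero_power_prefix)
  then have "((f oo g) * h) $ n = (\<Sum>i=0..n. \<Sum>k=0..n. f $ k * (g ^ k) $ i * h $ (n - i))"
    by (simp add: fps_mult_nth sum_distrib_right)
  also have "\<dots> = (\<Sum>k=0..n. \<Sum>i=0..n. f $ k * (g ^ k) $ i * h $ (n - i))"
    by (rule sum.swap)
  finally show ?thesis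
    by (simp add: fps_mult_nth sum_distrib_left mult.assoc)
qed

theorem theorem7:
  fixes lam x :: real and p :: int and n :: nat
  assumes "lam \<noteq> 0"
  shows "degen_poly_Bernoulli p lam n x =
    (\<Sum>k=0..n. (- lam) ^ k * degen_ffact (1 / lam) (k + 1) 1 / real (k + 1) powi p
                * degen_Stirling2 (- lam) n k (x - real k))"
proof -
  define u where "u = 1 - degen_exp (- lam) (- 1)"
  define c where "c k = (- lam) ^ k * degen_ffact (1 / lam) (k + 1) 1 / real (k + 1) powi p" for k
  define g where "g = Abs_fps (\<lambda>k. c k / fact k)"
  have u: "1 - (degen_exp lam 1 oo (- fps_X)) = u"
    by (simp add: u_def degen_exp_compose_uminus_X)
  then have "u \<noteq> 0"
    using subdegree_one_minus_degen_exp[of lam] by auto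
  have u0: "u $ 0 = 0"
    by (simp add: u_def degen_exp_def degen_ffact_def)
  \<comment> \<open>The polylogarithm starts at index 1; substituting u turns the split-off
    \<open>fps_X\<close> into the factor u that the division cancels.\<close>
  have "degen_polylog p lam = fps_X * g"
    by (rule fps_ext) (simp add: degen_polylog_def g_def c_def)
  then have "(degen_polylog p lam oo u) / u = g oo u"
    using u0 \<open>u \<noteq> 0\<close> by (simp add: fps_compose_mult_distrib)
  then have "degen_poly_Bernoulli p lam n x = fact n * ((g oo u) * degen_exp (- lam) x) $ n"
    by (simp add: degen_poly_Bernoulli_def Let_def u_def degen_exp_compose_uminus_X)
  also have "\<dots> = (\<Sum>k=0..n. c k * (fact n * (1 / fact k * (u ^ k * degen_exp (- lam) x) $ n)))"
    unfolding fps_compose_mult_nth[OF u0] sum_distrib_left by (simp add: g_def mult_ac)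
  also have "\<dots> = (\<Sum>k=0..n. c k * degen_Stirling2 (- lam) n k (x - real k))"
    using assms
    by (simp add: degen_Stirling2_def u_def degen_exp_minus_1_power mult.assoc)
  finally show ?thesis
    by (simp add: c_def)
qed

end
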